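(* Let $n\ge 3$ and let $f(t)=\dfrac{1}{1-t}$ for $t\in(-\infty,1)$. Then the function $X\mapsto CM(\exp X)$ is quasiconvex on the set $\mathbb{R}^{n\times n}$ of $n\times n$ matrices, and the function $X\mapsto T(\exp X)=f(CM(\exp X))$ is convex on $\mathbb{R}^{n\times n}$.
   Context: For $X=(x_{ij})\in\mathbb{R}^{n\times n}$, $\exp X$ denotes the entrywise exponential, i.e. the positive matrix with entries $e^{x_{ij}}$. For positive reals $a,b,c$ let $$CM(a,b,c)=\min\left\{\frac1a\left|a-\frac bc\right|,\ \frac1b\left|b-ac\right|,\ \frac1c\left|c-\frac ba\right|\right\},\qquad T(a,b,c)=\max\left\{\frac{ac}{b},\frac{b}{ac}\right\}.$$ For an $n\times n$ matrix $A=(a_{ij})$ with positive entries (in particular for a pairwise comparison matrix, i.e. one with $a_{ij}=1/a_{ji}$ for all $i,j$), $$CM(A)=\max\{CM(a_{ij},a_{ik},a_{jk}) : 1\le i<j<k\le n\},\qquad T(A)=\max\{T(a_{ij},a_{ik},a_{jk}) : 1\le i<j<k\le n\}.$$ A real function is quasiconvex if all its lower level sets are convex. *)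

theory Defs
  imports "HOL-Analysis.Analysis"
begin

definition CM_triple :: "real \<Rightarrow> real \<Rightarrow> real \<Rightarrow> real" where
  "CM_triple a b c =
     Min {1 / a * \<bar>a - b / c\<bar>, 1 / b * \<bar>b - a * c\<bar>, 1 / c * \<bar>c - b / a\<bar>}"

definition T_triple :: "real \<Rightarrow> real \<Rightarrow> real \<Rightarrow> real" where
  "T_triple a b c = max (a * c / b) (b / (a * c))"

text \<open>An arbitrary finite linearly ordered index type plays the role of \<open>{1..n}\<close>, with \<open>n = CARD('n)\<close>.
  The two maxima below range over a nonempty set only if \<open>CARD('n) \<ge> 3\<close>.\<close>

definition CM :: "real ^ 'n::{finite,linorder} ^ 'n::{finite,linorder} \<Rightarrow> real" where
  "CM A = Max {CM_triple (A $ i $ j) (A $ i $ k) (A $ j $ k) | i j k. i < j \<and> j < k}"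

definition T :: "real ^ 'n::{finite,linorder} ^ 'n::{finite,linorder} \<Rightarrow> real" where
  "T A = Max {T_triple (A $ i $ j) (A $ i $ k) (A $ j $ k) | i j k. i < j \<and> j < k}"

definition quasiconvex_on :: "'a::real_vector set \<Rightarrow> ('a \<Rightarrow> real) \<Rightarrow> bool" where
  "quasiconvex_on S f \<longleftrightarrow> (\<forall>\<alpha>. convex {x \<in> S. f x \<le> \<alpha>})"

end

theory Submission
  imports Defs
begin

text \<open>
  Everything about a triple depends only on the ratio \<open>r = a * c / b\<close>. The three terms of the minimum
  defining \<open>CM_triple\<close> are \<open>\<bar>1 - 1 / r\<bar>\<close> (twice) and \<open>\<bar>1 - r\<bar>\<close>. The smaller of these two
  values is \<open>1 - 1 / max r (1 / r)\<close>, that is, \<open>1 - 1 / T\<close> with \<open>T\<close> the value of \<open>T_triple\<close>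
  (lemma \<open>CM_triple_eq\<close>). Since \<open>t \<mapsto> 1 - 1 / t\<close> is increasing for \<open>t > 0\<close>, the identity
  passes to the maxima over all triples (lemma \<open>CM_eq\<close>), and solving it for \<open>T\<close> gives
  \<open>T = 1 / (1 - CM)\<close>.

  After the entrywise exponential, \<open>r\<close> and \<open>1 / r\<close> become exponentials of linear functionals of the
  matrix, hence convex functions, and \<open>T\<close> is a maximum of finitely many of them, hence convex
  (lemma \<open>convex_on_T_exp\<close>). Finally \<open>CM\<close> is an increasing function of the convex function \<open>T\<close>, so
  each of its lower level sets is one of \<open>T\<close> or the whole space.
\<close>

text \<open>Both maxima over triples are taken over the image of this set, which makes finiteness and
  nonemptiness, on which the use of \<open>Max\<close> depends, visible.\<close>

definition increasing_triples :: "('n \<times> 'n \<times> 'n::{finite,linorder}) set" where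
  "increasing_triples = {(i, j, k). i < j \<and> j < k}"

lemma increasing_triples_nonempty:
  assumes "CARD('n::{finite,linorder}) \<ge> 3"
  shows "(increasing_triples :: ('n \<times> 'n \<times> 'n) set) \<noteq> {}"
proof -
  let ?i = "Min (UNIV :: 'n set)" and ?k = "Max (UNIV :: 'n set)"
  have "card {?i, ?k} \<le> 2"
    by (simp add: card_insert_if)
  then have "{?i, ?k} \<noteq> UNIV"
    using assms by (metis not_less_eq_eq numeral_2_eq_2 numeral_3_eq_3 order_trans)
  then obtain j where "j \<noteq> ?i" "j \<noteq> ?k"
    by blast
  then have "?i < j" "j < ?k"
    by (simp_all add: order.not_eq_order_implies_strict)
  then show ?thesis
    by (auto simp: increasing_triples_def)
qed

lemma CM_altdef:
  "CM A = Max ((\<lambda>(i, j, k). CM_triple (A $ i $ j) (A $ i $ k) (A $ j $ k)) ` increasing_triples)"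
  unfolding CM_def increasing_triples_def by (rule arg_cong[where f = Max]) (force simp: image_iff)

lemma T_altdef:
  "T A = Max ((\<lambda>(i, j, k). T_triple (A $ i $ j) (A $ i $ k) (A $ j $ k)) ` increasing_triples)"
  unfolding T_def increasing_triples_def by (rule arg_cong[where f = Max]) (force simp: image_iff)

lemma T_triple_ge_1:
  assumes "a > 0" "b > 0" "c > 0"
  shows "T_triple a b c \<ge> 1"
  using assms by (auto simp: T_triple_def le_max_iff_disj divide_simps)

lemma CM_triple_eq:
  assumes "a > 0" "b > 0" "c > 0"
  shows "CM_triple a b c = 1 - 1 / T_triple a b c"
proof -
  define r where "r = a * c / b"
  have r: "r > 0"
    using assms by (simp add: r_def)
  have "1 / a * \<bar>a - b / c\<bar> = \<bar>1 - 1 / r\<bar>" "1 / b * \<bar>b - a * c\<bar> = \<bar>1 - r\<bar>"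
    "1 / c * \<bar>c - b / a\<bar> = \<bar>1 - 1 / r\<bar>"
    using assms by (auto simp: r_def abs_if field_simps)
  then have CM: "CM_triple a b c = min \<bar>1 - 1 / r\<bar> \<bar>1 - r\<bar>"
    by (simp add: CM_triple_def min.commute)
  have T: "T_triple a b c = max r (1 / r)"
    by (simp add: T_triple_def r_def)
  \<comment> \<open>On either side of \<open>r = 1\<close>, the two absolute values differ by \<open>(r - 1)\<^sup>2 / r\<close>, and the value
    coming from whichever of \<open>r\<close> and \<open>1 / r\<close> is at most \<open>1\<close> is the smaller one.\<close>
  show ?thesis
  proof (cases "r \<ge> 1")
    case True
    have "1 - 1 / r \<le> r - 1"
    proof -
      have "0 \<le> (r - 1)\<^sup>2 / r"
        using r by simp
      also have "\<dots> = (r - 1) - (1 - 1 / r)"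
        using r by (simp add: power2_eq_square field_simps)
      finally show ?thesis by simp
    qed
    moreover have "1 / r \<le> 1"
      using True by simp
    ultimately show ?thesis
      unfolding CM T using True by (simp add: max_absorb1 order_trans[of "1 / r" 1 r])
  next
    case False
    have "1 - r \<le> 1 / r - 1"
    proof -
      have "0 \<le> (r - 1)\<^sup>2 / r"
        using r by simp
      also have "\<dots> = (1 / r - 1) - (1 - r)"
        using r by (simp add: power2_eq_square field_simps)
      finally show ?thesis by simp
    qed
    moreover have "1 / r \<ge> 1"
      using False r by simp
    ultimately show ?thesis
      unfolding CM T using False r by (simp add: max_absorb2 order_trans[of r 1 "1 / r"])
  qed
qed

text \<open>Monotonicity is required on \<open>S\<close> only because \<open>t \<mapsto> 1 - 1 / t\<close>, to which this is applied,
  increases for positive \<open>t\<close> but jumps down when \<open>t\<close> passes \<open>0\<close>.\<close>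

lemma Max_image_mono_on:
  fixes g :: "'a::linorder \<Rightarrow> 'b::linorder"
  assumes "finite S" "S \<noteq> {}" "mono_on S g"
  shows "Max (g ` S) = g (Max S)"
  using assms(1) Max_in[OF assms(1,2)] by (intro Max_eqI) (auto intro: mono_onD[OF assms(3)])

text \<open>The bound \<open>T A \<ge> 1\<close> keeps the denominator away from \<open>0\<close>, so that the identity for \<open>CM A\<close> can be
  solved for \<open>T A\<close> and forces \<open>CM A < 1\<close>.\<close>

lemma
  fixes A :: "((real, 'n::{finite,linorder}) vec, 'n) vec"
  assumes n: "CARD('n) \<ge> 3" and pos: "\<And>i j. A $ i $ j > 0"
  shows T_ge_1: "T A \<ge> 1" and CM_eq: "CM A = 1 - 1 / T A"
proof -
  define S where
    "S = (\<lambda>(i, j, k). T_triple (A $ i $ j) (A $ i $ k) (A $ j $ k)) ` increasing_triples"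
  have S: "finite S" "S \<noteq> {}"
    using increasing_triples_nonempty[OF n] by (auto simp: S_def)
  have T: "T A = Max S"
    by (simp add: T_altdef S_def)
  have ge_1: "t \<ge> 1" if "t \<in> S" for t
    using that pos by (auto simp: S_def intro!: T_triple_ge_1)
  show "T A \<ge> 1"
    unfolding T using S by (intro ge_1 Max_in)
  have "mono_on S (\<lambda>t. 1 - 1 / t)"
    using ge_1 by (force intro!: mono_onI frac_le)
  moreover have "CM A = Max ((\<lambda>t. 1 - 1 / t) ` S)"
    by (simp add: CM_altdef S_def image_image case_prod_unfold CM_triple_eq pos)
  ultimately show "CM A = 1 - 1 / T A"
    using S by (simp add: T Max_image_mono_on)
qed

lemma convex_on_max:
  assumes "convex_on S f" "convex_on S g"
  shows "convex_on S (\<lambda>x. max (f x) (g x))"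
proof (rule convex_onI)
  fix t x y assume t: "0 < t" "t < (1::real)" and xy: "x \<in> S" "y \<in> S"
  let ?z = "(1 - t) *\<^sub>R x + t *\<^sub>R y"
  have "h ?z \<le> (1 - t) * max (f x) (g x) + t * max (f y) (g y)"
    if "convex_on S h" "h x \<le> max (f x) (g x)" "h y \<le> max (f y) (g y)" for h
  proof -
    have "h ?z \<le> (1 - t) * h x + t * h y"
      using convex_onD[OF that(1)] t xy by simp
    also have "\<dots> \<le> (1 - t) * max (f x) (g x) + t * max (f y) (g y)"
      using t that by (intro add_mono mult_left_mono) auto
    finally show ?thesis .
  qed
  from this[OF assms(1)] this[OF assms(2)]
  show "max (f ?z) (g ?z) \<le> (1 - t) * max (f x) (g x) + t * max (f y) (g y)"
    by simp
qed (use assms convex_on_imp_convex in blast)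

lemma convex_on_Max_image:
  assumes "finite I" "I \<noteq> {}" "\<And>i. i \<in> I \<Longrightarrow> convex_on S (f i)"
  shows "convex_on S (\<lambda>x. Max ((\<lambda>i. f i x) ` I))"
  using assms by (induction rule: finite_ne_induct) (auto intro: convex_on_max)

lemma convex_on_exp_linear:
  assumes "linear l"
  shows "convex_on UNIV (\<lambda>x. exp (l x) :: real)"
proof (rule convex_onI)
  fix t x y assume "0 < t" "t < (1::real)"
  then show "exp (l ((1 - t) *\<^sub>R x + t *\<^sub>R y)) \<le> (1 - t) * exp (l x) + t * exp (l y)"
    using convex_onD[OF exp_convex, of t "l x" "l y"]
    by (simp add: linear_add[OF assms] linear_scale[OF assms])
qed simp

lemma T_triple_exp:
  "T_triple (exp x) (exp y) (exp z) = max (exp (x + z - y)) (exp (y - x - z))"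
  by (simp add: T_triple_def exp_add exp_diff)

text \<open>By \<open>T_triple_exp\<close>, every triple contributes the maximum of the exponentials of two opposite linear
  functionals of \<open>X\<close>. The maximum over the triples keeps this convexity.\<close>

lemma convex_on_T_exp:
  assumes n: "CARD('n::{finite,linorder}) \<ge> 3"
  shows "convex_on UNIV (\<lambda>X :: ((real, 'n) vec, 'n) vec. T (map_matrix exp X))"
proof -
  have "convex_on UNIV (\<lambda>X :: ((real, 'n) vec, 'n) vec.
          T_triple (exp (X $ i $ j)) (exp (X $ i $ k)) (exp (X $ j $ k)))" for i j k
    unfolding T_triple_exp
    by (intro convex_on_max convex_on_exp_linear linearI) (simp_all add: algebra_simps)
  then show ?thesis
    unfolding T_altdef nth_map_matrix case_prod_unfold
    using increasing_triples_nonempty[OF n] by (intro convex_on_Max_image) auto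
qed

lemma convex_sublevel_set:
  assumes "convex_on S f"
  shows "convex {x \<in> S. f x \<le> \<alpha>}"
proof (rule convexI)
  fix x y u v assume *: "x \<in> {x \<in> S. f x \<le> \<alpha>}" "y \<in> {x \<in> S. f x \<le> \<alpha>}"
    and uv: "0 \<le> u" "0 \<le> v" "u + v = (1::real)"
  then have "f (u *\<^sub>R x + v *\<^sub>R y) \<le> max (f x) (f y)"
    using convex_lower[OF assms] by blast
  then show "u *\<^sub>R x + v *\<^sub>R y \<in> {x \<in> S. f x \<le> \<alpha>}"
    using * uv convex_on_imp_convex[OF assms] by (auto intro: convexD)
qed

theorem theorem4:
  fixes f :: "real \<Rightarrow> real"
  assumes n: "CARD('n::{finite,linorder}) \<ge> 3"
    and f: "\<And>t. t < 1 \<Longrightarrow> f t = 1 / (1 - t)"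
  shows "quasiconvex_on UNIV (\<lambda>X :: ((real, 'n) vec, 'n) vec. CM (map_matrix exp X))
    \<and> (\<forall>X :: ((real, 'n) vec, 'n) vec. CM (map_matrix exp X) < 1
          \<and> T (map_matrix exp X) = f (CM (map_matrix exp X)))
    \<and> convex_on UNIV (\<lambda>X :: ((real, 'n) vec, 'n) vec. T (map_matrix exp X))"
proof (intro conjI allI)
  have T: "T (map_matrix exp X) \<ge> 1"
    and CM: "CM (map_matrix exp X) = 1 - 1 / T (map_matrix exp X)" for X :: "((real, 'n) vec, 'n) vec"
    by (simp_all add: T_ge_1[OF n] CM_eq[OF n])
  show less: "CM (map_matrix exp X) < 1" for X :: "((real, 'n) vec, 'n) vec"
    using T[of X] by (simp add: CM)
  show "T (map_matrix exp X) = f (CM (map_matrix exp X))" for X :: "((real, 'n) vec, 'n) vec"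
    unfolding f[OF less] by (simp add: CM)
  show convex: "convex_on UNIV (\<lambda>X :: ((real, 'n) vec, 'n) vec. T (map_matrix exp X))"
    by (rule convex_on_T_exp[OF n])
  show "quasiconvex_on UNIV (\<lambda>X :: ((real, 'n) vec, 'n) vec. CM (map_matrix exp X))"
    unfolding quasiconvex_on_def
  proof
    fix \<alpha> :: real
    show "convex {X \<in> UNIV. CM (map_matrix exp (X :: ((real, 'n) vec, 'n) vec)) \<le> \<alpha>}"
    proof (cases "\<alpha> < 1")
      case True
      have "CM (map_matrix exp X) \<le> \<alpha> \<longleftrightarrow> T (map_matrix exp X) \<le> 1 / (1 - \<alpha>)"
        for X :: "((real, 'n) vec, 'n) vec"
        using T[of X] True by (auto simp: CM field_simps)
      then show ?thesis
        using convex_sublevel_set[OF convex] by simp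
    next
      case False
      then have "CM (map_matrix exp X) \<le> \<alpha>" for X :: "((real, 'n) vec, 'n) vec"
        using less[of X] by simp
      then show ?thesis
        by simp
    qed
  qed
qed

end
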